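(* The lattice (ordered by inclusion) of finitary explosive extensions of $\mathsf{BD}$ is dually isomorphic to the lattice (ordered by inclusion) of homomorphic classes of non-empty graphs.
   Context: Formulas are built from a countably infinite set of variables using $\wedge,\vee$, ${\sim}$, $\top,\bot$. A logic is a set of rules $\Gamma\vdash\varphi$ ($\Gamma$ a set of formulas) closed under reflexivity, monotonicity, cut and substitution; it is finitary if $\Gamma\vdash\varphi$ implies $\Gamma'\vdash\varphi$ for some finite $\Gamma'\subseteq\Gamma$. $\mathsf{BD}$ is the set of rules valid in the matrix $\langle\mathbf{DM}_4,\{b,\top\}\rangle$, where $\mathbf{DM}_4$ is the De Morgan algebra on $\{\bot,n,b,\top\}$ with $\bot<n,b<\top$ ($n,b$ incomparable), ${\sim}$ swapping $\top,\bot$ and fixing $n,b$; a rule is valid if every valuation sending the premises into the designated set sends the conclusion there. An explosive rule is a rule $\Gamma\vdash p$ where the variable $p$ does not occur in $\Gamma$; an explosive extension of $\mathsf{BD}$ is the least logic containing $\mathsf{BD}$ and some set of explosive rules. A graph is a finite set $X$ with a symmetric binary relation $R$ (loops allowed); a homomorphism $(X,R)\to(Y,S)$ is a map $h$ with $uRv\Rightarrow h(u)Sh(v)$. A homomorphic class of non-empty graphs is a class $\mathcal K$ of non-empty graphs such that if $G\in\mathcal K$, $H$ is non-empty and there is a homomorphism $G\to H$, then $H\in\mathcal K$. *)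

theory Defs
  imports Main "HOL-Library.FuncSet" "HOL-Library.Infinite_Typeclass" "HOL-Algebra.Lattice"
begin

datatype fm =
    Var nat
  | Conj fm fm
  | Disj fm fm
  | Neg fm
  | Verum
  | Falsum

primrec vars :: "fm \<Rightarrow> nat set" where
  "vars (Var p) = {p}"
| "vars (Conj \<phi> \<psi>) = vars \<phi> \<union> vars \<psi>"
| "vars (Disj \<phi> \<psi>) = vars \<phi> \<union> vars \<psi>"
| "vars (Neg \<phi>) = vars \<phi>"
| "vars Verum = {}"
| "vars Falsum = {}"

primrec subst :: "(nat \<Rightarrow> fm) \<Rightarrow> fm \<Rightarrow> fm" where
  "subst \<sigma> (Var p) = \<sigma> p"
| "subst \<sigma> (Conj \<phi> \<psi>) = Conj (subst \<sigma> \<phi>) (subst \<sigma> \<psi>)"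
| "subst \<sigma> (Disj \<phi> \<psi>) = Disj (subst \<sigma> \<phi>) (subst \<sigma> \<psi>)"
| "subst \<sigma> (Neg \<phi>) = Neg (subst \<sigma> \<phi>)"
| "subst \<sigma> Verum = Verum"
| "subst \<sigma> Falsum = Falsum"

text \<open>A pair \<open>(\<Gamma>, \<phi>)\<close> stands for the rule \<open>\<Gamma> \<turnstile> \<phi>\<close>; \<open>\<Gamma>\<close> may be infinite.\<close>

type_synonym rule = "fm set \<times> fm"

text \<open>Logics need not be finitary, so cut is stated for an arbitrary set of cut formulas.\<close>

definition is_logic :: "rule set \<Rightarrow> bool" where
  "is_logic L \<longleftrightarrow>
     (\<forall>\<Gamma> \<phi>. \<phi> \<in> \<Gamma> \<longrightarrow> (\<Gamma>, \<phi>) \<in> L) \<and>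
     (\<forall>\<Gamma> \<Delta> \<phi>. (\<Gamma>, \<phi>) \<in> L \<and> \<Gamma> \<subseteq> \<Delta> \<longrightarrow> (\<Delta>, \<phi>) \<in> L) \<and>
     (\<forall>\<Gamma> \<Delta> \<phi>. (\<forall>\<delta>\<in>\<Delta>. (\<Gamma>, \<delta>) \<in> L) \<and> (\<Gamma> \<union> \<Delta>, \<phi>) \<in> L \<longrightarrow> (\<Gamma>, \<phi>) \<in> L) \<and>
     (\<forall>\<Gamma> \<phi> \<sigma>. (\<Gamma>, \<phi>) \<in> L \<longrightarrow> (subst \<sigma> ` \<Gamma>, subst \<sigma> \<phi>) \<in> L)"

definition finitary :: "rule set \<Rightarrow> bool" where
  "finitary L \<longleftrightarrow> (\<forall>(\<Gamma>, \<phi>)\<in>L. \<exists>\<Gamma>'\<subseteq>\<Gamma>. finite \<Gamma>' \<and> (\<Gamma>', \<phi>) \<in> L)"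

datatype dm4 = F | N | B | T

instantiation dm4 :: "{distrib_lattice, bounded_lattice}"
begin

definition less_eq_dm4 :: "dm4 \<Rightarrow> dm4 \<Rightarrow> bool" where
  "less_eq_dm4 x y \<longleftrightarrow> x = y \<or> x = F \<or> y = T"

definition less_dm4 :: "dm4 \<Rightarrow> dm4 \<Rightarrow> bool" where
  "less_dm4 x y \<longleftrightarrow> x \<le> y \<and> x \<noteq> y"

definition inf_dm4 :: "dm4 \<Rightarrow> dm4 \<Rightarrow> dm4" where
  "inf_dm4 x y = (if x \<le> y then x else if y \<le> x then y else F)"

definition sup_dm4 :: "dm4 \<Rightarrow> dm4 \<Rightarrow> dm4" where
  "sup_dm4 x y = (if x \<le> y then y else if y \<le> x then x else T)"

definition bot_dm4 :: dm4 where "bot_dm4 = F"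

definition top_dm4 :: dm4 where "top_dm4 = T"

instance
proof
  fix x y z :: dm4
  show "sup x (inf y z) = inf (sup x y) (sup x z)"
    by (cases x; cases y; cases z) (simp_all add: inf_dm4_def sup_dm4_def less_eq_dm4_def)
qed (auto simp: less_eq_dm4_def less_dm4_def inf_dm4_def sup_dm4_def bot_dm4_def top_dm4_def)

end

primrec neg4 :: "dm4 \<Rightarrow> dm4" where
  "neg4 F = T"
| "neg4 N = N"
| "neg4 B = B"
| "neg4 T = F"

primrec eval :: "(nat \<Rightarrow> dm4) \<Rightarrow> fm \<Rightarrow> dm4" where
  "eval v (Var p) = v p"
| "eval v (Conj \<phi> \<psi>) = inf (eval v \<phi>) (eval v \<psi>)"
| "eval v (Disj \<phi> \<psi>) = sup (eval v \<phi>) (eval v \<psi>)"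
| "eval v (Neg \<phi>) = neg4 (eval v \<phi>)"
| "eval v Verum = T"
| "eval v Falsum = F"

definition BD :: "rule set" where
  "BD = {(\<Gamma>, \<phi>). \<forall>v. (\<forall>\<gamma>\<in>\<Gamma>. eval v \<gamma> \<in> {B, T}) \<longrightarrow> eval v \<phi> \<in> {B, T}}"

definition explosive_rules :: "rule set" where
  "explosive_rules = {(\<Gamma>, Var p) | \<Gamma> p. p \<notin> (\<Union>\<gamma>\<in>\<Gamma>. vars \<gamma>)}"

definition explosive_extension :: "rule set \<Rightarrow> bool" where
  "explosive_extension L \<longleftrightarrow> (\<exists>E \<subseteq> explosive_rules. L = is_logic hull (BD \<union> E))"

text \<open>
  HOL has no proper classes, so the vertices of graphs are drawn from a type \<open>'v\<close>. If \<open>'v\<close> is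
  infinite, every finite graph has an isomorphic copy over \<open>'v\<close>. As a homomorphic class is closed
  under isomorphism, it is determined by its members over \<open>'v\<close>.
\<close>

type_synonym 'v graph = "'v set \<times> ('v \<times> 'v) set"

definition is_graph :: "'v graph \<Rightarrow> bool" where
  "is_graph G \<longleftrightarrow> finite (fst G) \<and> snd G \<subseteq> fst G \<times> fst G \<and> sym (snd G)"

definition graph_hom :: "('v \<Rightarrow> 'w) \<Rightarrow> 'v graph \<Rightarrow> 'w graph \<Rightarrow> bool" where
  "graph_hom h G H \<longleftrightarrow>
     h \<in> fst G \<rightarrow> fst H \<and> (\<forall>u v. (u, v) \<in> snd G \<longrightarrow> (h u, h v) \<in> snd H)"

definition nonempty_graphs :: "'v graph set" where
  "nonempty_graphs = {G. is_graph G \<and> fst G \<noteq> {}}"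

definition homomorphic_class :: "'v graph set \<Rightarrow> bool" where
  "homomorphic_class K \<longleftrightarrow>
     K \<subseteq> nonempty_graphs \<and>
     (\<forall>G\<in>K. \<forall>H\<in>nonempty_graphs. (\<exists>h. graph_hom h G H) \<longrightarrow> H \<in> K)"

definition inclusion_order :: "'a set set \<Rightarrow> 'a set gorder" where
  "inclusion_order A = \<lparr>carrier = A, eq = (=), le = (\<subseteq>)\<rparr>"

definition dually_isomorphic :: "'a gorder \<Rightarrow> 'b gorder \<Rightarrow> bool" where
  "dually_isomorphic L M \<longleftrightarrow>
     (\<exists>f. bij_betw f (carrier L) (carrier M) \<and>
          (\<forall>x\<in>carrier L. \<forall>y\<in>carrier L. x \<sqsubseteq>\<^bsub>L\<^esub> y \<longleftrightarrow> f y \<sqsubseteq>\<^bsub>M\<^esub> f x))"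

definition finitary_explosive_extensions :: "rule set gorder" where
  "finitary_explosive_extensions = inclusion_order {L. explosive_extension L \<and> finitary L}"

definition homomorphic_classes :: "'v graph set gorder" where
  "homomorphic_classes = inclusion_order {K. homomorphic_class K}"

end

theory Submission
  imports Defs
begin

text \<open>
  A set \<open>\<Gamma>\<close> of formulas is read as the graph whose vertices are the valuations designating \<open>\<Gamma>\<close>;
  two of them are adjacent unless one makes true what the other makes false.
  Substitutions \<open>\<sigma>\<close> with \<open>\<Gamma> \<turnstile> \<sigma>[\<Delta>]\<close> in \<open>BD\<close> induce homomorphisms from the graph of \<open>\<Gamma>\<close> to the graph
  of \<open>\<Delta>\<close>, and for finite \<open>\<Gamma>\<close> every such homomorphism yields a substitution, because finite
  valuations are described by conjunctions of literals. Every finite graph is homomorphically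
  equivalent to the graph of a formula. As an explosive extension \<open>L\<close> of \<open>BD\<close> adds to \<open>BD\<close>
  only the rules whose premises are inconsistent in \<open>L\<close>, a finitary one is determined by its finite
  inconsistent sets, i.e. by a class of graphs closed under homomorphic preimages, and the
  dual isomorphism takes the complement of this class.
\<close>

section \<open>Truth and falsity in the four-element De Morgan algebra\<close>

text \<open>A truth value is treated as two independent bits, told true (\<open>holds\<close>) and
  told false (\<open>fails\<close>): \<open>B\<close> has both, \<open>N\<close> neither. On these
  bits the connectives act classically, with negation swapping them.\<close>

definition holds :: "dm4 \<Rightarrow> bool" where "holds x \<longleftrightarrow> x \<in> {B, T}"

definition fails :: "dm4 \<Rightarrow> bool" where "fails x \<longleftrightarrow> x \<in> {B, F}"

lemma holds_simps [simp]:
  "holds (inf x y) \<longleftrightarrow> holds x \<and> holds y"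
  "holds (sup x y) \<longleftrightarrow> holds x \<or> holds y"
  "holds (neg4 x) \<longleftrightarrow> fails x"
  "holds T" "\<not> holds F" "holds B" "\<not> holds N"
  by (cases x; cases y; simp add: holds_def fails_def inf_dm4_def sup_dm4_def less_eq_dm4_def)+

lemma fails_simps [simp]:
  "fails (inf x y) \<longleftrightarrow> fails x \<or> fails y"
  "fails (sup x y) \<longleftrightarrow> fails x \<and> fails y"
  "fails (neg4 x) \<longleftrightarrow> holds x"
  "\<not> fails T" "fails F" "fails B" "\<not> fails N"
  by (cases x; cases y; simp add: holds_def fails_def inf_dm4_def sup_dm4_def less_eq_dm4_def)+

lemma dm4_with_bits: "\<exists>x. holds x = a \<and> fails x = b"
proof -
  have "holds (if a then if b then B else T else if b then F else N) = a \<and>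
        fails (if a then if b then B else T else if b then F else N) = b"
    by simp
  then show ?thesis by blast
qed

lemma BD_iff: "(\<Gamma>, \<phi>) \<in> BD \<longleftrightarrow> (\<forall>v. (\<forall>\<gamma>\<in>\<Gamma>. holds (eval v \<gamma>)) \<longrightarrow> holds (eval v \<phi>))"
  by (simp add: BD_def holds_def)

lemma eval_subst: "eval v (subst \<sigma> \<phi>) = eval (\<lambda>p. eval v (\<sigma> p)) \<phi>"
  by (induction \<phi>) simp_all

lemma eval_cong: "(\<And>p. p \<in> vars \<phi> \<Longrightarrow> v p = w p) \<Longrightarrow> eval v \<phi> = eval w \<phi>"
  by (induction \<phi>) simp_all

lemma subst_cong: "(\<And>p. p \<in> vars \<phi> \<Longrightarrow> \<sigma> p = \<tau> p) \<Longrightarrow> subst \<sigma> \<phi> = subst \<tau> \<phi>"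
  by (induction \<phi>) simp_all

lemma subst_Var [simp]: "subst Var \<phi> = \<phi>"
  by (induction \<phi>) simp_all

lemma finite_vars [simp]: "finite (vars \<phi>)"
  by (induction \<phi>) simp_all

lemma finite_UNIV_dm4: "finite (UNIV :: dm4 set)"
proof -
  have "(UNIV :: dm4 set) = {F, N, B, T}" using dm4.exhaust by blast
  then show ?thesis by (metis finite.emptyI finite.insertI)
qed

section \<open>Explosive extensions\<close>

lemma is_logic_BD: "is_logic BD"
  unfolding is_logic_def BD_iff by (auto simp: eval_subst)

lemma is_logic_refl: "is_logic L \<Longrightarrow> \<phi> \<in> \<Gamma> \<Longrightarrow> (\<Gamma>, \<phi>) \<in> L"
  by (drule is_logic_def[THEN iffD1, THEN conjunct1]) blast

lemma is_logic_mono: "is_logic L \<Longrightarrow> (\<Gamma>, \<phi>) \<in> L \<Longrightarrow> \<Gamma> \<subseteq> \<Delta> \<Longrightarrow> (\<Delta>, \<phi>) \<in> L"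
  by (drule is_logic_def[THEN iffD1, THEN conjunct2, THEN conjunct1]) blast

lemma is_logic_subst: "is_logic L \<Longrightarrow> (\<Gamma>, \<phi>) \<in> L \<Longrightarrow> (subst \<sigma> ` \<Gamma>, subst \<sigma> \<phi>) \<in> L"
  by (drule is_logic_def[THEN iffD1, THEN conjunct2, THEN conjunct2, THEN conjunct2]) blast

lemma is_logic_cut:
  assumes "is_logic L" "\<And>\<delta>. \<delta> \<in> \<Delta> \<Longrightarrow> (\<Gamma>, \<delta>) \<in> L" "(\<Delta>, \<phi>) \<in> L"
  shows "(\<Gamma>, \<phi>) \<in> L"
proof -
  have "(\<Gamma> \<union> \<Delta>, \<phi>) \<in> L" using is_logic_mono[OF assms(1,3)] by blast
  with is_logic_def[THEN iffD1, OF assms(1), THEN conjunct2, THEN conjunct2, THEN conjunct1] assms(2)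
  show ?thesis by blast
qed

lemma is_logic_cut_subst:
  assumes "is_logic L" "BD \<subseteq> L" "\<forall>\<delta>\<in>\<Delta>. (\<Gamma>, subst \<sigma> \<delta>) \<in> BD" "(subst \<sigma> ` \<Delta>, \<phi>) \<in> L"
  shows "(\<Gamma>, \<phi>) \<in> L"
proof (rule is_logic_cut[OF assms(1) _ assms(4)])
  fix \<delta> assume "\<delta> \<in> subst \<sigma> ` \<Delta>"
  then show "(\<Gamma>, \<delta>) \<in> L" using assms(2,3) by auto
qed

text \<open>One use of an explosive rule, up to \<open>BD\<close>. The conclusion
  \<open>\<psi>\<close> is ignored: being a variable absent from \<open>\<Delta>\<close>, it can be
  instantiated at will.\<close>

definition refuted :: "rule set \<Rightarrow> fm set \<Rightarrow> bool" where
  "refuted E \<Gamma> \<longleftrightarrow> (\<exists>(\<Delta>, \<psi>)\<in>E. \<exists>\<sigma>. \<forall>\<delta>\<in>\<Delta>. (\<Gamma>, subst \<sigma> \<delta>) \<in> BD)"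

lemma refutedI: "(\<Delta>, \<psi>) \<in> E \<Longrightarrow> refuted E \<Delta>"
  unfolding refuted_def
  by (rule bexI[of _ "(\<Delta>, \<psi>)"]) (auto intro!: exI[of _ Var] is_logic_refl[OF is_logic_BD])

lemma refuted_cut:
  assumes "\<And>\<delta>. \<delta> \<in> \<Delta> \<Longrightarrow> (\<Gamma>, \<delta>) \<in> BD" "refuted E \<Delta>"
  shows "refuted E \<Gamma>"
proof -
  have "(\<Delta>, \<phi>) \<in> BD \<Longrightarrow> (\<Gamma>, \<phi>) \<in> BD" for \<phi>
    using is_logic_cut[OF is_logic_BD assms(1)] .
  then show ?thesis using assms(2) unfolding refuted_def by blast
qed

lemma refuted_subst:
  assumes "refuted E \<Gamma>"
  shows "refuted E (subst \<sigma> ` \<Gamma>)"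
proof -
  obtain \<Delta> \<psi> \<tau> where *: "(\<Delta>, \<psi>) \<in> E" "\<forall>\<delta>\<in>\<Delta>. (\<Gamma>, subst \<tau> \<delta>) \<in> BD"
    using assms unfolding refuted_def by blast
  have "subst \<sigma> (subst \<tau> \<delta>) = subst (\<lambda>p. subst \<sigma> (\<tau> p)) \<delta>" for \<delta>
    by (induction \<delta>) simp_all
  with * have "\<forall>\<delta>\<in>\<Delta>. (subst \<sigma> ` \<Gamma>, subst (\<lambda>p. subst \<sigma> (\<tau> p)) \<delta>) \<in> BD"
    using is_logic_subst[OF is_logic_BD] by metis
  with *(1) show ?thesis unfolding refuted_def by blast
qed

text \<open>Being refuted is inherited backwards along \<open>BD\<close>-consequence and is
  preserved by substitution, so a single application of a rule from \<open>E\<close> absorbs nested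
  ones.\<close>

lemma is_logic_BD_refuted: "is_logic (BD \<union> {(\<Gamma>, \<phi>). refuted E \<Gamma>})" (is "is_logic ?L")
  unfolding is_logic_def
proof (intro conjI allI impI)
  fix \<Gamma> and \<phi> :: fm assume "\<phi> \<in> \<Gamma>"
  then show "(\<Gamma>, \<phi>) \<in> ?L" by (simp add: is_logic_refl[OF is_logic_BD])
next
  fix \<Gamma> \<Delta> \<phi> assume *: "(\<Gamma>, \<phi>) \<in> ?L \<and> \<Gamma> \<subseteq> \<Delta>"
  then have "(\<Delta>, \<gamma>) \<in> BD" if "\<gamma> \<in> \<Gamma>" for \<gamma>
    using that is_logic_refl[OF is_logic_BD] by blast
  with * show "(\<Delta>, \<phi>) \<in> ?L"
    using refuted_cut[of \<Gamma> \<Delta> E] is_logic_cut[OF is_logic_BD, of \<Gamma> \<Delta> \<phi>] by blast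
next
  fix \<Gamma> \<Delta> \<phi> assume *: "(\<forall>\<delta>\<in>\<Delta>. (\<Gamma>, \<delta>) \<in> ?L) \<and> (\<Gamma> \<union> \<Delta>, \<phi>) \<in> ?L"
  show "(\<Gamma>, \<phi>) \<in> ?L"
  proof (cases "refuted E \<Gamma>")
    \<comment> \<open>Now no cut formula can come from refutation, so all of them are
      \<open>BD\<close>-consequences of \<open>\<Gamma>\<close>.\<close>
    case False
    then have "(\<Gamma>, \<delta>) \<in> BD" if "\<delta> \<in> \<Gamma> \<union> \<Delta>" for \<delta>
      using that * is_logic_refl[OF is_logic_BD, of \<delta> \<Gamma>] by blast
    then show ?thesis
      using * refuted_cut[of "\<Gamma> \<union> \<Delta>" \<Gamma> E] is_logic_cut[OF is_logic_BD, of "\<Gamma> \<union> \<Delta>" \<Gamma> \<phi>]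
      by blast
  qed simp
next
  fix \<Gamma> \<phi> \<sigma> assume "(\<Gamma>, \<phi>) \<in> ?L"
  then show "(subst \<sigma> ` \<Gamma>, subst \<sigma> \<phi>) \<in> ?L"
    using refuted_subst[of E \<Gamma> \<sigma>] is_logic_subst[OF is_logic_BD, of \<Gamma> \<phi> \<sigma>] by blast
qed

lemma hull_explosive_rules:
  assumes E: "E \<subseteq> explosive_rules"
  shows "is_logic hull (BD \<union> E) = BD \<union> {(\<Gamma>, \<phi>). refuted E \<Gamma>}" (is "_ = ?L")
proof (rule hull_unique)
  show "BD \<union> E \<subseteq> ?L" by (auto intro: refutedI)
  show "is_logic ?L" by (rule is_logic_BD_refuted)
  fix L assume L: "BD \<union> E \<subseteq> L" "is_logic L"
  have "(\<Gamma>, \<phi>) \<in> L" if "refuted E \<Gamma>" for \<Gamma> \<phi>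
  proof -
    obtain \<Delta> \<psi> \<sigma> where *: "(\<Delta>, \<psi>) \<in> E" "\<forall>\<delta>\<in>\<Delta>. (\<Gamma>, subst \<sigma> \<delta>) \<in> BD"
      using \<open>refuted E \<Gamma>\<close> unfolding refuted_def by blast
    obtain p where p: "\<psi> = Var p" "p \<notin> (\<Union>\<gamma>\<in>\<Delta>. vars \<gamma>)"
      using *(1) E unfolding explosive_rules_def by blast
    \<comment> \<open>Redirecting the fresh variable \<open>p\<close> to \<open>\<phi>\<close>
      leaves the premises alone and turns the conclusion into an arbitrary formula.\<close>
    have eq: "subst (\<sigma>(p := \<phi>)) \<delta> = subst \<sigma> \<delta>" if "\<delta> \<in> \<Delta>" for \<delta>
      using p that by (intro subst_cong) auto
    have "(subst (\<sigma>(p := \<phi>)) ` \<Delta>, subst (\<sigma>(p := \<phi>)) \<psi>) \<in> L"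
      using * L by (intro is_logic_subst) auto
    then have "(subst \<sigma> ` \<Delta>, \<phi>) \<in> L" using p eq by (simp cong: image_cong)
    with L *(2) show ?thesis by (intro is_logic_cut_subst[of L \<Delta> \<Gamma> \<sigma>]) simp_all
  qed
  then show "?L \<subseteq> L" using L by auto
qed

lemma explosive_extension_is_logic:
  assumes "explosive_extension L"
  shows "is_logic L" "BD \<subseteq> L"
proof -
  obtain E where E: "E \<subseteq> explosive_rules" and L: "L = is_logic hull (BD \<union> E)"
    using assms unfolding explosive_extension_def by blast
  show "is_logic L" unfolding L hull_explosive_rules[OF E] by (rule is_logic_BD_refuted)
  show "BD \<subseteq> L" unfolding L hull_explosive_rules[OF E] by blast
qed

text \<open>Refutation does not look at the conclusion, so a rule beyond \<open>BD\<close> already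
  yields \<open>Falsum\<close>. Hence \<open>(\<Gamma>, Falsum) \<in> L\<close> can serve as
  inconsistency of \<open>\<Gamma>\<close> in \<open>L\<close>.\<close>

lemma explosive_extension_cases:
  assumes "explosive_extension L" "(\<Gamma>, \<phi>) \<in> L"
  shows "(\<Gamma>, \<phi>) \<in> BD \<or> (\<Gamma>, Falsum) \<in> L"
proof -
  obtain E where E: "E \<subseteq> explosive_rules" and L: "L = is_logic hull (BD \<union> E)"
    using assms(1) unfolding explosive_extension_def by blast
  show ?thesis using assms(2) unfolding L hull_explosive_rules[OF E] by blast
qed

lemma ex_falso:
  assumes "is_logic L" "BD \<subseteq> L" "(\<Gamma>, Falsum) \<in> L"
  shows "(\<Gamma>, \<phi>) \<in> L"
proof (rule is_logic_cut[OF assms(1)])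
  show "({Falsum}, \<phi>) \<in> L" using assms(2) by (rule subsetD) (simp add: BD_iff)
qed (use assms(3) in simp)

section \<open>Compactness\<close>

text \<open>Koenig's lemma on the four-branching tree of initial segments of valuations; each
  constraint \<open>Q i\<close> looks only at finitely many variables.\<close>

lemma valuation_compactness:
  fixes Q :: "'i \<Rightarrow> (nat \<Rightarrow> dm4) \<Rightarrow> bool"
  assumes fin: "\<And>S. S \<subseteq> I \<Longrightarrow> finite S \<Longrightarrow> \<exists>v. \<forall>i\<in>S. Q i v"
    and loc: "\<And>i. i \<in> I \<Longrightarrow> \<exists>n. \<forall>v w. (\<forall>j<n. v j = w j) \<longrightarrow> Q i v \<longrightarrow> Q i w"
  shows "\<exists>v. \<forall>i\<in>I. Q i v"
proof -
  define ext where "ext n w S \<longleftrightarrow> (\<exists>v. (\<forall>j<n. v j = w j) \<and> (\<forall>i\<in>S. Q i v))"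
    for n and w :: "nat \<Rightarrow> dm4" and S
  \<comment> \<open>The first \<open>n\<close> values of \<open>w\<close> are still extendable to
    meet any finite set of constraints.\<close>
  define ok where "ok n w \<longleftrightarrow> (\<forall>S. S \<subseteq> I \<longrightarrow> finite S \<longrightarrow> ext n w S)" for n w
  have step: "\<exists>x. ok (Suc n) (w(n := x))" if "ok n w" for n w
  proof (rule ccontr)
    assume "\<nexists>x. ok (Suc n) (w(n := x))"
    then have "\<forall>x. \<exists>S. S \<subseteq> I \<and> finite S \<and> \<not> ext (Suc n) (w(n := x)) S"
      unfolding ok_def by simp
    then obtain S where S: "\<And>x. S x \<subseteq> I" "\<And>x. finite (S x)"
      and no: "\<And>x. \<not> ext (Suc n) (w(n := x)) (S x)"
      by (auto dest!: choice)
    \<comment> \<open>If every value \<open>x\<close> had its own finite obstruction, the union of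
      these four sets would be a finite obstruction to \<open>w\<close> itself.\<close>
    have "(\<Union>x. S x) \<subseteq> I" "finite (\<Union>x. S x)"
      using S finite_UNIV_dm4 by auto
    then have "ext n w (\<Union>x. S x)" using \<open>ok n w\<close> by (simp add: ok_def)
    then obtain v where v: "\<forall>j<n. v j = w j" "\<forall>i\<in>(\<Union>x. S x). Q i v"
      unfolding ext_def by blast
    then have "ext (Suc n) (w(n := v n)) (S (v n))"
      unfolding ext_def by (intro exI[of _ v]) (auto simp: less_Suc_eq)
    then show False using no by simp
  qed
  have "\<exists>f. \<forall>n. ok n (f n) \<and> (\<forall>j<n. f (Suc n) j = f n j)"
  proof (rule dependent_nat_choice)
    show "\<exists>w. ok 0 w" using fin by (simp add: ok_def ext_def)
    fix w n assume "ok n w"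
    then obtain x where "ok (Suc n) (w(n := x))" using step by blast
    then show "\<exists>w'. ok (Suc n) w' \<and> (\<forall>j<n. w' j = w j)"
      by (intro exI[of _ "w(n := x)"]) simp
  qed
  then obtain f where f: "\<And>n. ok n (f n)" "\<And>n j. j < n \<Longrightarrow> f (Suc n) j = f n j"
    by blast
  have f_eq: "f n j = f (Suc j) j" if "j < n" for n j
    using that by (induction n) (auto simp: f(2) less_Suc_eq)
  \<comment> \<open>The limit valuation is the diagonal: entry \<open>j\<close> is final from stage
    \<open>Suc j\<close> on.\<close>
  have "Q i (\<lambda>j. f (Suc j) j)" if i: "i \<in> I" for i
  proof -
    obtain n where n: "\<And>v w. (\<forall>j<n. v j = w j) \<Longrightarrow> Q i v \<Longrightarrow> Q i w" using loc[OF i] by blast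
    have "ext n (f n) {i}" using f(1)[of n] i by (simp add: ok_def)
    then obtain v where "\<forall>j<n. v j = f n j" "Q i v" unfolding ext_def by blast
    moreover from this(1) have "\<forall>j<n. v j = f (Suc j) j" using f_eq by metis
    ultimately show ?thesis by (blast intro: n)
  qed
  then show ?thesis by blast
qed

lemma finitary_BD: "finitary BD"
proof -
  have "\<exists>\<Gamma>'\<subseteq>\<Gamma>. finite \<Gamma>' \<and> (\<Gamma>', \<phi>) \<in> BD" if BD: "(\<Gamma>, \<phi>) \<in> BD" for \<Gamma> \<phi>
  proof (rule ccontr)
    assume no: "\<not> ?thesis"
    define Q where "Q \<gamma> v \<longleftrightarrow> holds (eval v \<gamma>) \<and> \<not> holds (eval v \<phi>)" for \<gamma> v
    \<comment> \<open>Adding \<open>Verum\<close> makes the index set nonempty, so that the failure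
      of \<open>\<phi>\<close> is imposed even when \<open>\<Gamma>\<close> is empty.\<close>
    have "\<exists>v. \<forall>\<gamma>\<in>insert Verum \<Gamma>. Q \<gamma> v"
    proof (rule valuation_compactness)
      fix S assume S: "S \<subseteq> insert Verum \<Gamma>" "finite S"
      then have "(S - {Verum}, \<phi>) \<notin> BD" using no by blast
      then obtain v where "\<forall>\<gamma>\<in>S - {Verum}. holds (eval v \<gamma>)" "\<not> holds (eval v \<phi>)"
        unfolding BD_iff by blast
      then have "\<forall>\<gamma>\<in>S. Q \<gamma> v" by (auto simp: Q_def)
      then show "\<exists>v. \<forall>\<gamma>\<in>S. Q \<gamma> v" by blast
    next
      fix \<gamma>
      have "finite (vars \<gamma> \<union> vars \<phi>)" by simp
      then obtain n where n: "\<forall>j\<in>vars \<gamma> \<union> vars \<phi>. j < n"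
        unfolding finite_nat_set_iff_bounded by blast
      have "Q \<gamma> w" if "\<forall>j<n. v j = w j" "Q \<gamma> v" for v w
      proof -
        have "eval v \<gamma> = eval w \<gamma>" "eval v \<phi> = eval w \<phi>"
          using n that(1) by (auto intro!: eval_cong)
        with that(2) show ?thesis by (simp add: Q_def)
      qed
      then show "\<exists>n. \<forall>v w. (\<forall>j<n. v j = w j) \<longrightarrow> Q \<gamma> v \<longrightarrow> Q \<gamma> w" by blast
    qed
    then obtain v where "\<forall>\<gamma>\<in>insert Verum \<Gamma>. Q \<gamma> v" by blast
    then show False using BD unfolding BD_iff Q_def by blast
  qed
  then show ?thesis unfolding finitary_def by blast
qed

text \<open>A refutation uses the finitely many premises of one rule, and by compactness of
  \<open>BD\<close> each follows from a finite part of \<open>\<Gamma>\<close>.\<close>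

lemma finitary_hull_explosive_rules:
  assumes E: "E \<subseteq> explosive_rules" and fin: "\<And>\<Delta> \<psi>. (\<Delta>, \<psi>) \<in> E \<Longrightarrow> finite \<Delta>"
  shows "finitary (is_logic hull (BD \<union> E))"
proof -
  have BD_fin: "\<exists>\<Gamma>'\<subseteq>\<Gamma>. finite \<Gamma>' \<and> (\<Gamma>', \<phi>) \<in> BD" if "(\<Gamma>, \<phi>) \<in> BD" for \<Gamma> \<phi>
    using finitary_BD that unfolding finitary_def by blast
  have ref_fin: "\<exists>\<Gamma>'\<subseteq>\<Gamma>. finite \<Gamma>' \<and> refuted E \<Gamma>'" if "refuted E \<Gamma>" for \<Gamma>
  proof -
    obtain \<Delta> \<psi> \<sigma> where *: "(\<Delta>, \<psi>) \<in> E" "\<forall>\<delta>\<in>\<Delta>. (\<Gamma>, subst \<sigma> \<delta>) \<in> BD"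
      using \<open>refuted E \<Gamma>\<close> unfolding refuted_def by blast
    have "\<forall>\<delta>\<in>\<Delta>. \<exists>\<Gamma>'. \<Gamma>' \<subseteq> \<Gamma> \<and> finite \<Gamma>' \<and> (\<Gamma>', subst \<sigma> \<delta>) \<in> BD"
      using *(2) BD_fin by blast
    then obtain G where G: "\<forall>\<delta>\<in>\<Delta>. G \<delta> \<subseteq> \<Gamma> \<and> finite (G \<delta>) \<and> (G \<delta>, subst \<sigma> \<delta>) \<in> BD"
      by (rule bchoice[THEN exE])
    have "\<forall>\<delta>\<in>\<Delta>. (\<Union>(G ` \<Delta>), subst \<sigma> \<delta>) \<in> BD"
    proof
      fix \<delta> assume "\<delta> \<in> \<Delta>"
      then show "(\<Union>(G ` \<Delta>), subst \<sigma> \<delta>) \<in> BD"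
        using G by (rule_tac is_logic_mono[OF is_logic_BD, of "G \<delta>"]) auto
    qed
    then have "refuted E (\<Union>(G ` \<Delta>))" using * unfolding refuted_def by blast
    moreover have "\<Union>(G ` \<Delta>) \<subseteq> \<Gamma>" "finite (\<Union>(G ` \<Delta>))" using G fin *(1) by auto
    ultimately show ?thesis by blast
  qed
  show ?thesis
    unfolding finitary_def hull_explosive_rules[OF E]
  proof (clarsimp, elim disjE)
    fix \<Gamma> \<phi>
    show "\<exists>\<Gamma>'\<subseteq>\<Gamma>. finite \<Gamma>' \<and> ((\<Gamma>', \<phi>) \<in> BD \<or> refuted E \<Gamma>')" if "(\<Gamma>, \<phi>) \<in> BD"
      using BD_fin[OF that] by blast
    show "\<exists>\<Gamma>'\<subseteq>\<Gamma>. finite \<Gamma>' \<and> ((\<Gamma>', \<phi>) \<in> BD \<or> refuted E \<Gamma>')" if "refuted E \<Gamma>"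
      using ref_fin[OF that] by blast
  qed
qed

section \<open>Valuations as vertices\<close>

text \<open>The adjacency relation. It is not reflexive: a valuation has a loop exactly if it never
  takes the value \<open>B\<close>.\<close>

definition compat :: "(nat \<Rightarrow> dm4) \<Rightarrow> (nat \<Rightarrow> dm4) \<Rightarrow> bool" where
  "compat v w \<longleftrightarrow> (\<forall>p. \<not> (holds (v p) \<and> fails (w p)) \<and> \<not> (fails (v p) \<and> holds (w p)))"

text \<open>The pointwise information order, with \<open>N\<close> at the bottom and
  \<open>B\<close> at the top. Hence \<open>N\<close> is the default value of restricted valuations
  below.\<close>

definition info_le :: "(nat \<Rightarrow> dm4) \<Rightarrow> (nat \<Rightarrow> dm4) \<Rightarrow> bool" where
  "info_le v w \<longleftrightarrow> (\<forall>p. (holds (v p) \<longrightarrow> holds (w p)) \<and> (fails (v p) \<longrightarrow> fails (w p)))"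

definition supported_on :: "nat set \<Rightarrow> (nat \<Rightarrow> dm4) \<Rightarrow> bool" where
  "supported_on P v \<longleftrightarrow> (\<forall>p. p \<notin> P \<longrightarrow> v p = N)"

definition restrict_val :: "nat set \<Rightarrow> (nat \<Rightarrow> dm4) \<Rightarrow> nat \<Rightarrow> dm4" where
  "restrict_val P v = (\<lambda>p. if p \<in> P then v p else N)"

definition models :: "fm set \<Rightarrow> (nat \<Rightarrow> dm4) set" where
  "models \<Gamma> = {v. \<forall>\<gamma>\<in>\<Gamma>. holds (eval v \<gamma>)}"

text \<open>Valuations of all variables are vertices, so this is usually infinite and need not
  satisfy \<open>is_graph\<close>.\<close>

definition model_graph :: "fm set \<Rightarrow> (nat \<Rightarrow> dm4) graph" where
  "model_graph \<Gamma> = (models \<Gamma>, {(v, w). v \<in> models \<Gamma> \<and> w \<in> models \<Gamma> \<and> compat v w})"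

lemma compat_sym: "compat v w \<Longrightarrow> compat w v"
  unfolding compat_def by blast

lemma compat_mono: "compat v w \<Longrightarrow> info_le v' v \<Longrightarrow> info_le w' w \<Longrightarrow> compat v' w'"
  unfolding compat_def info_le_def by blast

lemma info_le_restrict_val: "info_le (restrict_val P v) v"
  by (simp add: info_le_def restrict_val_def)

lemma supported_restrict_val: "supported_on P (restrict_val P v)"
  by (simp add: supported_on_def restrict_val_def)

text \<open>Both clashes are treated in one induction because \<open>Neg\<close> exchanges them;
  likewise for the two bits in the next lemma.\<close>

lemma compat_eval:
  "compat v w \<Longrightarrow> \<not> (holds (eval v \<phi>) \<and> fails (eval w \<phi>)) \<and> \<not> (fails (eval v \<phi>) \<and> holds (eval w \<phi>))"
  by (induction \<phi>) (auto simp: compat_def)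

lemma info_le_eval:
  "info_le v w \<Longrightarrow> (holds (eval v \<phi>) \<longrightarrow> holds (eval w \<phi>)) \<and> (fails (eval v \<phi>) \<longrightarrow> fails (eval w \<phi>))"
  by (induction \<phi>) (auto simp: info_le_def)

lemma restrict_val_models:
  assumes "(\<Union>\<gamma>\<in>\<Gamma>. vars \<gamma>) \<subseteq> P" "v \<in> models \<Gamma>"
  shows "restrict_val P v \<in> models \<Gamma>"
proof -
  have "eval (restrict_val P v) \<gamma> = eval v \<gamma>" if "\<gamma> \<in> \<Gamma>" for \<gamma>
    using that assms(1) by (intro eval_cong) (auto simp: restrict_val_def)
  then show ?thesis using assms(2) by (simp add: models_def)
qed

lemma finite_supported_on:
  assumes "finite P"
  shows "finite {v. supported_on P v}"
proof -
  have "finite {v :: nat \<Rightarrow> dm4. \<forall>x. (x \<in> P \<longrightarrow> v x \<in> UNIV) \<and> (x \<notin> P \<longrightarrow> v x = N)}"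
    using assms finite_UNIV_dm4 by (rule finite_set_of_finite_funs)
  then show ?thesis by (simp add: supported_on_def)
qed

section \<open>Formulas describing finitely supported valuations\<close>

lemma finite_conjunction:
  assumes "finite S"
  shows "\<exists>\<phi>. \<forall>v. (holds (eval v \<phi>) \<longleftrightarrow> (\<forall>\<psi>\<in>S. holds (eval v \<psi>))) \<and>
                 (fails (eval v \<phi>) \<longleftrightarrow> (\<exists>\<psi>\<in>S. fails (eval v \<psi>)))"
  using assms
proof induction
  case empty
  show ?case by (rule exI[of _ Verum]) simp
next
  case (insert \<psi> S)
  then obtain \<phi> where "\<forall>v. (holds (eval v \<phi>) \<longleftrightarrow> (\<forall>\<psi>\<in>S. holds (eval v \<psi>))) \<and>
                 (fails (eval v \<phi>) \<longleftrightarrow> (\<exists>\<psi>\<in>S. fails (eval v \<psi>)))"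
    by blast
  then show ?case by (intro exI[of _ "Conj \<psi> \<phi>"]) simp
qed

lemma finite_disjunction:
  assumes "finite S"
  shows "\<exists>\<phi>. \<forall>v. (holds (eval v \<phi>) \<longleftrightarrow> (\<exists>\<psi>\<in>S. holds (eval v \<psi>))) \<and>
                 (fails (eval v \<phi>) \<longleftrightarrow> (\<forall>\<psi>\<in>S. fails (eval v \<psi>)))"
proof -
  have "finite (Neg ` S)" using assms by simp
  from finite_conjunction[OF this] obtain \<phi> where
    "\<forall>v. (holds (eval v \<phi>) \<longleftrightarrow> (\<forall>\<psi>\<in>S. fails (eval v \<psi>))) \<and>
         (fails (eval v \<phi>) \<longleftrightarrow> (\<exists>\<psi>\<in>S. holds (eval v \<psi>)))"
    by auto
  then show ?thesis by (intro exI[of _ "Neg \<phi>"]) simp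
qed

text \<open>Take the conjunction of the literals that \<open>u\<close> makes true, both literals of
  \<open>p\<close> if \<open>u p = B\<close>. It is false at \<open>v\<close> when some literal is,
  which means that \<open>v\<close> clashes with \<open>u\<close>; so falsity encodes
  non-adjacency.\<close>

lemma characteristic_formula:
  assumes "finite P" "supported_on P u"
  shows "\<exists>\<phi>. \<forall>v. (holds (eval v \<phi>) \<longleftrightarrow> info_le u v) \<and> (fails (eval v \<phi>) \<longleftrightarrow> \<not> compat u v)"
proof -
  define S where "S = Var ` {p \<in> P. holds (u p)} \<union> (Neg \<circ> Var) ` {p \<in> P. fails (u p)}"
  have supp: "p \<in> P" if "holds (u p) \<or> fails (u p)" for p
    using assms(2) that unfolding supported_on_def by (metis holds_simps(7) fails_simps(7))
  have "finite S" using assms(1) by (simp add: S_def)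
  from finite_conjunction[OF this] obtain \<phi> where
    \<phi>: "\<And>v. holds (eval v \<phi>) \<longleftrightarrow> (\<forall>\<psi>\<in>S. holds (eval v \<psi>))"
       "\<And>v. fails (eval v \<phi>) \<longleftrightarrow> (\<exists>\<psi>\<in>S. fails (eval v \<psi>))"
    by blast
  have "(\<forall>\<psi>\<in>S. holds (eval v \<psi>)) \<longleftrightarrow>
      (\<forall>p\<in>P. (holds (u p) \<longrightarrow> holds (v p)) \<and> (fails (u p) \<longrightarrow> fails (v p)))" for v
    by (auto simp: S_def ball_Un)
  then have "holds (eval v \<phi>) \<longleftrightarrow> info_le u v" for v
    unfolding \<phi> info_le_def using supp by blast
  moreover have "(\<exists>\<psi>\<in>S. fails (eval v \<psi>)) \<longleftrightarrow>
      (\<exists>p\<in>P. holds (u p) \<and> fails (v p) \<or> fails (u p) \<and> holds (v p))" for v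
    by (auto simp: S_def bex_Un)
  then have "fails (eval v \<phi>) \<longleftrightarrow> \<not> compat u v" for v
    unfolding \<phi> compat_def using supp by blast
  ultimately show ?thesis by blast
qed

lemma characteristic_formulas:
  assumes "finite P"
  shows "\<exists>C. \<forall>u. supported_on P u \<longrightarrow>
      (\<forall>v. (holds (eval v (C u)) \<longleftrightarrow> info_le u v) \<and> (fails (eval v (C u)) \<longleftrightarrow> \<not> compat u v))"
proof (rule choice, rule allI)
  show "\<exists>\<phi>. supported_on P u \<longrightarrow>
      (\<forall>v. (holds (eval v \<phi>) \<longleftrightarrow> info_le u v) \<and> (fails (eval v \<phi>) \<longleftrightarrow> \<not> compat u v))" for u
    using characteristic_formula[OF assms, of u] by blast
qed

section \<open>Substitutions and homomorphisms between model graphs\<close>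

lemma graph_hom_comp: "graph_hom h G H \<Longrightarrow> graph_hom k H I \<Longrightarrow> graph_hom (k \<circ> h) G I"
  unfolding graph_hom_def by auto

lemma graph_hom_of_substitution:
  assumes "\<forall>\<delta>\<in>\<Delta>. (\<Gamma>, subst \<sigma> \<delta>) \<in> BD"
  shows "graph_hom (\<lambda>v p. eval v (\<sigma> p)) (model_graph \<Gamma>) (model_graph \<Delta>)"
proof -
  have "(\<lambda>p. eval v (\<sigma> p)) \<in> models \<Delta>" if "v \<in> models \<Gamma>" for v
    using assms that by (auto simp: models_def BD_iff eval_subst)
  moreover have "compat (\<lambda>p. eval v (\<sigma> p)) (\<lambda>p. eval w (\<sigma> p))" if "compat v w" for v w
    using compat_eval[OF that] by (subst compat_def) simp
  ultimately show ?thesis by (auto simp: graph_hom_def model_graph_def)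
qed

text \<open>Let \<open>\<sigma> p\<close> be the disjunction of the characteristic formulas of those
  vertices \<open>u\<close> of finite support whose image makes \<open>p\<close> true. At a model
  \<open>v\<close> with restriction \<open>u\<close>, the valuation induced by
  \<open>\<sigma>\<close> lies above \<open>h u\<close> in information, and truth of
  \<open>\<delta>\<close> passes upwards.\<close>

lemma substitution_of_graph_hom:
  assumes "finite \<Gamma>" and h: "graph_hom h (model_graph \<Gamma>) (model_graph \<Delta>)"
  shows "\<exists>\<sigma>. \<forall>\<delta>\<in>\<Delta>. (\<Gamma>, subst \<sigma> \<delta>) \<in> BD"
proof -
  define P where "P = (\<Union>\<gamma>\<in>\<Gamma>. vars \<gamma>)"
  have "finite P" using assms(1) by (simp add: P_def)
  from characteristic_formulas[OF this] obtain C where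
    C: "\<And>u v. supported_on P u \<Longrightarrow> holds (eval v (C u)) \<longleftrightarrow> info_le u v"
       "\<And>u v. supported_on P u \<Longrightarrow> fails (eval v (C u)) \<longleftrightarrow> \<not> compat u v"
    by blast
  define U where "U p = {u \<in> models \<Gamma>. supported_on P u \<and> holds (h u p)}" for p
  have "finite (U p)" for p
    using finite_supported_on[OF \<open>finite P\<close>] by (rule rev_finite_subset) (auto simp: U_def)
  then have "\<forall>p. \<exists>\<phi>. \<forall>v. (holds (eval v \<phi>) \<longleftrightarrow> (\<exists>u\<in>U p. holds (eval v (C u)))) \<and>
                     (fails (eval v \<phi>) \<longleftrightarrow> (\<forall>u\<in>U p. fails (eval v (C u))))"
    using finite_disjunction[OF finite_imageI, of "U _" C] by simp
  from choice[OF this] obtain \<sigma> where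
    \<sigma>: "\<And>p v. holds (eval v (\<sigma> p)) \<longleftrightarrow> (\<exists>u\<in>U p. holds (eval v (C u)))"
       "\<And>p v. fails (eval v (\<sigma> p)) \<longleftrightarrow> (\<forall>u\<in>U p. fails (eval v (C u)))"
    by blast
  have "(\<Gamma>, subst \<sigma> \<delta>) \<in> BD" if "\<delta> \<in> \<Delta>" for \<delta>
    unfolding BD_iff
  proof (intro allI impI)
    fix v assume "\<forall>\<gamma>\<in>\<Gamma>. holds (eval v \<gamma>)"
    then have v: "v \<in> models \<Gamma>" by (simp add: models_def)
    define u where "u = restrict_val P v"
    have u: "u \<in> models \<Gamma>" "supported_on P u" "info_le u v"
      using v by (simp_all add: u_def restrict_val_models P_def supported_restrict_val info_le_restrict_val)
    have "info_le (h u) (\<lambda>p. eval v (\<sigma> p))"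
      unfolding info_le_def
    proof (intro allI conjI impI)
      fix p
      show "holds (eval v (\<sigma> p))" if "holds (h u p)"
        using that u C(1) \<sigma>(1) by (auto simp: U_def)
      \<comment> \<open>Each disjunct \<open>u'\<close> has an image clashing at \<open>p\<close>
        with that of \<open>u\<close>. As \<open>h\<close> preserves edges, \<open>u'\<close> and
        \<open>u\<close> clash too, and so do \<open>u'\<close> and \<open>v\<close>.\<close>
      show "fails (eval v (\<sigma> p))" if p: "fails (h u p)"
        unfolding \<sigma>(2)
      proof
        fix u' assume u': "u' \<in> U p"
        then have "\<not> compat (h u') (h u)" using p by (auto simp: compat_def U_def)
        then have "\<not> compat u' u"
          using h u u' by (auto simp: graph_hom_def model_graph_def U_def)
        then have "\<not> compat u' v"
          using compat_mono u(3) info_le_def by metis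
        then show "fails (eval v (C u'))" using C(2) u' by (simp add: U_def)
      qed
    qed
    moreover have "holds (eval (h u) \<delta>)"
      using h u(1) that by (auto simp: graph_hom_def model_graph_def models_def)
    ultimately show "holds (eval v (subst \<sigma> \<delta>))"
      unfolding eval_subst using info_le_eval by blast
  qed
  then show ?thesis by blast
qed

section \<open>Finite graphs and model graphs up to homomorphic equivalence\<close>

text \<open>Forgetting all variables outside \<open>\<Gamma>\<close> retracts the model graph onto a
  finite induced subgraph, since losing information preserves compatibility. An infinite
  \<open>'v\<close> has room for a copy.\<close>

lemma model_graph_finite_copy:
  assumes "finite \<Gamma>"
  shows "\<exists>(G :: 'v::infinite graph) h k. is_graph G \<and>
    graph_hom h G (model_graph \<Gamma>) \<and> graph_hom k (model_graph \<Gamma>) G"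
proof -
  define P where "P = (\<Union>\<gamma>\<in>\<Gamma>. vars \<gamma>)"
  define U where "U = {u \<in> models \<Gamma>. supported_on P u}"
  have "finite P" using assms by (simp add: P_def)
  then have "finite U"
    by (intro finite_subset[OF _ finite_supported_on[of P]]) (auto simp: U_def)
  obtain A :: "'v set" where "finite A" "card A = card U"
    using infinite_arbitrarily_large[OF infinite_UNIV] by blast
  with \<open>finite U\<close> obtain f where f: "bij_betw f U A"
    using finite_same_card_bij by metis
  define g where "g = inv_into U f"
  have gf: "g (f u) = u" if "u \<in> U" for u
    using f that by (simp add: g_def bij_betw_inv_into_left)
  have g: "g a \<in> U" if "a \<in> A" for a
    using f that by (metis g_def bij_betw_imp_surj_on inv_into_into)
  define G where "G = (A, {(a, b). a \<in> A \<and> b \<in> A \<and> compat (g a) (g b)})"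
  have res: "restrict_val P v \<in> U" if "v \<in> models \<Gamma>" for v
    using that by (simp add: U_def restrict_val_models P_def supported_restrict_val)
  have "is_graph G"
    using \<open>finite A\<close> by (auto simp: G_def is_graph_def sym_def intro: compat_sym)
  moreover have "graph_hom g G (model_graph \<Gamma>)"
    using g by (auto simp: graph_hom_def G_def model_graph_def U_def)
  moreover have "graph_hom (\<lambda>v. f (restrict_val P v)) (model_graph \<Gamma>) G"
    using res gf bij_betwE[OF f] compat_mono[OF _ info_le_restrict_val info_le_restrict_val]
    by (auto simp: graph_hom_def G_def model_graph_def)
  ultimately show ?thesis by blast
qed

text \<open>Vertices become valuations \<open>u x\<close> whose compatibility is adjacency in
  \<open>G\<close>, and \<open>\<gamma>\<close> is the disjunction of their characteristic formulas.
  A model of \<open>\<gamma>\<close> lies above some \<open>u x\<close>; choosing such an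
  \<open>x\<close> gives \<open>k\<close>, which preserves edges because compatibility passes down
  the information order.\<close>

lemma graph_realized_by_formula:
  assumes "is_graph G"
  shows "\<exists>\<gamma> h k. graph_hom h G (model_graph {\<gamma>}) \<and> graph_hom k (model_graph {\<gamma>}) G"
proof -
  have X: "finite (fst G)" and R: "snd G \<subseteq> fst G \<times> fst G" "sym (snd G)"
    using assms by (simp_all add: is_graph_def)
  obtain e :: "_ \<Rightarrow> nat" where e: "inj_on e (fst G)"
    using finite_imp_inj_to_nat_seg[OF X] by blast
  \<comment> \<open>The vertex \<open>x\<close> asserts its own variable and denies those of its non-neighbours.\<close>
  have "\<exists>u. \<forall>q. (holds (u q) \<longleftrightarrow> q = e x) \<and>
      (fails (u q) \<longleftrightarrow> (\<exists>y\<in>fst G. q = e y \<and> (x, y) \<notin> snd G))" for x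
    using dm4_with_bits by (intro choice allI)
  then obtain u where u: "\<And>x q. holds (u x q) \<longleftrightarrow> q = e x"
    "\<And>x q. fails (u x q) \<longleftrightarrow> (\<exists>y\<in>fst G. q = e y \<and> (x, y) \<notin> snd G)"
    by metis
  have compat_u: "compat (u x) (u y) \<longleftrightarrow> (x, y) \<in> snd G" if "x \<in> fst G" "y \<in> fst G" for x y
    using that e R(2) by (auto simp: compat_def u inj_on_eq_iff dest: symD)
  have "supported_on (e ` fst G) (u x)" if "x \<in> fst G" for x
    unfolding supported_on_def
  proof (intro allI impI)
    fix p assume "p \<notin> e ` fst G"
    then have "\<not> holds (u x p)" "\<not> fails (u x p)" using that by (auto simp: u)
    then show "u x p = N" by (cases "u x p") simp_all
  qed
  moreover have "finite (e ` fst G)" using X by simp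
  from characteristic_formulas[OF this] obtain C where
    "\<And>w v. supported_on (e ` fst G) w \<Longrightarrow> holds (eval v (C w)) \<longleftrightarrow> info_le w v"
    by blast
  moreover have "finite ((\<lambda>x. C (u x)) ` fst G)" using X by simp
  from finite_disjunction[OF this] obtain \<gamma>
    where "\<And>v. holds (eval v \<gamma>) \<longleftrightarrow> (\<exists>x\<in>fst G. holds (eval v (C (u x))))"
    by auto
  ultimately have \<gamma>: "v \<in> models {\<gamma>} \<longleftrightarrow> (\<exists>x\<in>fst G. info_le (u x) v)" for v
    by (simp add: models_def)
  then have "\<forall>v\<in>models {\<gamma>}. \<exists>x. x \<in> fst G \<and> info_le (u x) v" by blast
  from bchoice[OF this] obtain k
    where k: "\<And>v. v \<in> models {\<gamma>} \<Longrightarrow> k v \<in> fst G \<and> info_le (u (k v)) v"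
    by blast
  have "u x \<in> models {\<gamma>}" if "x \<in> fst G" for x
    using that by (auto simp: \<gamma> info_le_def)
  then have "graph_hom u G (model_graph {\<gamma>})"
    using R(1) compat_u by (auto simp: graph_hom_def model_graph_def)
  moreover have "graph_hom k (model_graph {\<gamma>}) G"
  proof -
    have "(k v, k w) \<in> snd G" if "v \<in> models {\<gamma>}" "w \<in> models {\<gamma>}" "compat v w" for v w
      using that k compat_mono compat_u by metis
    then show ?thesis using k by (auto simp: graph_hom_def model_graph_def)
  qed
  ultimately show ?thesis by blast
qed

section \<open>The dual isomorphism\<close>

definition consistent_graphs :: "rule set \<Rightarrow> 'v graph set" where
  "consistent_graphs L = {G \<in> nonempty_graphs.
     \<not> (\<exists>\<Gamma> h. finite \<Gamma> \<and> (\<Gamma>, Falsum) \<in> L \<and> graph_hom h G (model_graph \<Gamma>))}"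

lemma homomorphic_class_consistent_graphs: "homomorphic_class (consistent_graphs L)"
  unfolding homomorphic_class_def consistent_graphs_def
  using graph_hom_comp by fastforce

lemma consistent_graphs_antimono: "L \<subseteq> M \<Longrightarrow> consistent_graphs M \<subseteq> consistent_graphs L"
  unfolding consistent_graphs_def by blast

text \<open>By finitarity it suffices to treat finite \<open>\<Gamma>\<close>. If
  \<open>\<Gamma>\<close> is inconsistent in \<open>L\<close>, its finite copy is excluded for
  \<open>L\<close>, hence for \<open>M\<close>, so it maps into the graph of some
  \<open>M\<close>-inconsistent \<open>\<Delta>\<close>. The resulting substitution carries this
  inconsistency back to \<open>\<Gamma>\<close>.\<close>

lemma consistent_graphs_reflects:
  assumes L: "explosive_extension L" "finitary L" and M: "explosive_extension M"
    and sub: "(consistent_graphs M :: 'v::infinite graph set) \<subseteq> consistent_graphs L"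
  shows "L \<subseteq> M"
proof
  fix r assume "r \<in> L"
  then obtain \<Gamma>0 \<phi> where r: "r = (\<Gamma>0, \<phi>)" and "(\<Gamma>0, \<phi>) \<in> L" by (cases r) auto
  then obtain \<Gamma> where \<Gamma>: "\<Gamma> \<subseteq> \<Gamma>0" "finite \<Gamma>" "(\<Gamma>, \<phi>) \<in> L"
    using L(2) unfolding finitary_def by blast
  note logic = explosive_extension_is_logic[OF M]
  have "(\<Gamma>, Falsum) \<in> M" if incons: "(\<Gamma>, Falsum) \<in> L"
  proof -
    obtain G :: "'v graph" and h k where G: "is_graph G" "graph_hom h G (model_graph \<Gamma>)"
      "graph_hom k (model_graph \<Gamma>) G"
      using model_graph_finite_copy[OF \<Gamma>(2)] by blast
    show ?thesis
    proof (cases "fst G = {}")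
      \<comment> \<open>The empty graph lies in no class, but then \<open>\<Gamma>\<close> has no
        model and explodes already in \<open>BD\<close>.\<close>
      case True
      then have "models \<Gamma> = {}" using G(3) by (auto simp: graph_hom_def model_graph_def)
      then have "(\<Gamma>, Falsum) \<in> BD" by (auto simp: models_def BD_iff)
      then show ?thesis using logic(2) by blast
    next
      case False
      then have "G \<in> nonempty_graphs" using G(1) by (simp add: nonempty_graphs_def)
      moreover have "G \<notin> consistent_graphs L"
        using G(2) \<Gamma>(2) incons unfolding consistent_graphs_def by blast
      ultimately obtain \<Delta> l where \<Delta>: "(\<Delta>, Falsum) \<in> M" "graph_hom l G (model_graph \<Delta>)"
        using sub unfolding consistent_graphs_def by blast
      then obtain \<sigma> where \<sigma>: "\<forall>\<delta>\<in>\<Delta>. (\<Gamma>, subst \<sigma> \<delta>) \<in> BD"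
        using substitution_of_graph_hom[OF \<Gamma>(2)] graph_hom_comp[OF G(3)] by blast
      have "(subst \<sigma> ` \<Delta>, Falsum) \<in> M"
        using is_logic_subst[OF logic(1) \<Delta>(1)] by simp
      with logic \<sigma> show ?thesis by (rule is_logic_cut_subst)
    qed
  qed
  then have "(\<Gamma>, \<phi>) \<in> M"
    using explosive_extension_cases[OF L(1) \<Gamma>(3)] ex_falso[OF logic] logic(2) by blast
  then show "r \<in> M" using is_logic_mono[OF logic(1)] \<Gamma>(1) r by blast
qed

text \<open>Declare inconsistent every finite set whose graph receives no homomorphism from
  \<open>K\<close>. The formulas realizing graphs show that enough graphs are excluded;
  homomorphisms induced by substitutions show that no member of \<open>K\<close> is.\<close>

lemma consistent_graphs_surj:
  fixes K :: "'v graph set"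
  assumes K: "homomorphic_class K"
  shows "\<exists>L. explosive_extension L \<and> finitary L \<and> consistent_graphs L = K"
proof -
  define bad where "bad \<Delta> \<longleftrightarrow> finite \<Delta> \<and> (\<forall>G\<in>K. \<nexists>h. graph_hom h G (model_graph \<Delta>))" for \<Delta>
  define E where "E = {(\<Delta>, Var p) | \<Delta> p. bad \<Delta> \<and> p \<notin> (\<Union>\<gamma>\<in>\<Delta>. vars \<gamma>)}"
  define L where "L = is_logic hull (BD \<union> E)"
  have E: "E \<subseteq> explosive_rules" unfolding E_def explosive_rules_def by blast
  have ext: "explosive_extension L" unfolding explosive_extension_def L_def using E by blast
  have fin: "finitary L"
    unfolding L_def using E by (rule finitary_hull_explosive_rules) (auto simp: E_def bad_def)
  have K_ne: "fst G \<noteq> {}" "is_graph G" if "G \<in> K" for G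
    using K that unfolding homomorphic_class_def nonempty_graphs_def by auto
  have "consistent_graphs L \<subseteq> K"
  proof
    fix G :: "'v graph" assume G: "G \<in> consistent_graphs L"
    then have ne: "G \<in> nonempty_graphs" by (simp add: consistent_graphs_def)
    then obtain \<gamma> h k where hk: "graph_hom h G (model_graph {\<gamma>})" "graph_hom k (model_graph {\<gamma>}) G"
      using graph_realized_by_formula unfolding nonempty_graphs_def by blast
    have "({\<gamma>}, Falsum) \<notin> L"
      using G hk(1) unfolding consistent_graphs_def by blast
    moreover have "({\<gamma>}, Falsum) \<in> L" if "bad {\<gamma>}"
    proof -
      obtain p where "p \<notin> vars \<gamma>" using ex_new_if_finite[OF infinite_UNIV_nat finite_vars] by blast
      then have "({\<gamma>}, Var p) \<in> E" using that by (auto simp: E_def)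
      then have "refuted E {\<gamma>}" by (rule refutedI)
      then show ?thesis unfolding L_def hull_explosive_rules[OF E] by blast
    qed
    \<comment> \<open>As \<open>{\<gamma>}\<close> is not bad, some member of \<open>K\<close> maps
      to its graph and from there to \<open>G\<close> by \<open>k\<close>.\<close>
    ultimately obtain H l where "H \<in> K" "graph_hom l H (model_graph {\<gamma>})"
      unfolding bad_def by blast
    then show "G \<in> K"
      using K ne graph_hom_comp[OF _ hk(2)] unfolding homomorphic_class_def by blast
  qed
  moreover have "K \<subseteq> consistent_graphs L"
  proof
    fix G assume G: "G \<in> K"
    have False if \<Gamma>: "(\<Gamma>, Falsum) \<in> L" and h: "graph_hom h G (model_graph \<Gamma>)" for \<Gamma> h
    proof (cases "(\<Gamma>, Falsum) \<in> BD")
      case True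
      then have "models \<Gamma> = {}" by (auto simp: models_def BD_iff)
      \<comment> \<open>A nonempty graph has no map into the empty one; this is why graphs are
        required to be nonempty.\<close>
      then show False using h K_ne[OF G] by (auto simp: graph_hom_def model_graph_def)
    next
      case False
      then have "refuted E \<Gamma>" using \<Gamma> unfolding L_def hull_explosive_rules[OF E] by blast
      then obtain \<Delta> \<sigma> where "bad \<Delta>" "\<forall>\<delta>\<in>\<Delta>. (\<Gamma>, subst \<sigma> \<delta>) \<in> BD"
        unfolding refuted_def E_def by blast
      then show False
        using graph_hom_comp[OF h graph_hom_of_substitution] G unfolding bad_def by blast
    qed
    then show "G \<in> consistent_graphs L"
      using G K unfolding consistent_graphs_def homomorphic_class_def by blast
  qed
  ultimately show ?thesis using ext fin by blast
qed

lemma dually_isomorphic_extensions_classes: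
  "dually_isomorphic finitary_explosive_extensions
     (homomorphic_classes :: 'v::infinite graph set gorder)"
proof -
  let ?f = "consistent_graphs :: rule set \<Rightarrow> 'v graph set"
  let ?A = "{L. explosive_extension L \<and> finitary L}"
  have le: "L \<subseteq> M \<longleftrightarrow> ?f M \<subseteq> ?f L" if "L \<in> ?A" "M \<in> ?A" for L M
    using that consistent_graphs_antimono consistent_graphs_reflects by blast
  have "inj_on ?f ?A" by (rule inj_onI) (use le in blast)
  moreover have "?f ` ?A = {K. homomorphic_class K}"
    using homomorphic_class_consistent_graphs consistent_graphs_surj by blast
  ultimately show ?thesis
    using le unfolding dually_isomorphic_def finitary_explosive_extensions_def
      homomorphic_classes_def inclusion_order_def bij_betw_def
    by (intro exI[of _ ?f]) simp
qed

section \<open>Lattice structure of both orders\<close>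

lemma partial_order_inclusion_order: "partial_order (inclusion_order A)"
  by unfold_locales (auto simp: inclusion_order_def)

lemma lattice_inclusion_orderI:
  assumes "\<And>x y. x \<in> A \<Longrightarrow> y \<in> A \<Longrightarrow> \<exists>s\<in>A. \<forall>z\<in>A. s \<subseteq> z \<longleftrightarrow> x \<subseteq> z \<and> y \<subseteq> z"
    and "\<And>x y. x \<in> A \<Longrightarrow> y \<in> A \<Longrightarrow> \<exists>i\<in>A. \<forall>z\<in>A. z \<subseteq> i \<longleftrightarrow> z \<subseteq> x \<and> z \<subseteq> y"
  shows "lattice (inclusion_order A)"
proof -
  interpret partial_order "inclusion_order A" by (rule partial_order_inclusion_order)
  show ?thesis
  proof unfold_locales
    fix x y assume "x \<in> carrier (inclusion_order A)" "y \<in> carrier (inclusion_order A)"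
    then have xy: "x \<in> A" "y \<in> A" by (simp_all add: inclusion_order_def)
    have "Upper (inclusion_order A) {x, y} = {z \<in> A. x \<subseteq> z \<and> y \<subseteq> z}"
      using xy unfolding Upper_def inclusion_order_def by auto
    moreover obtain s where "s \<in> A" "\<forall>z\<in>A. s \<subseteq> z \<longleftrightarrow> x \<subseteq> z \<and> y \<subseteq> z"
      using assms(1)[OF xy] by blast
    ultimately have "least (inclusion_order A) s (Upper (inclusion_order A) {x, y})"
      by (simp add: least_def inclusion_order_def) blast
    then show "\<exists>s. least (inclusion_order A) s (Upper (inclusion_order A) {x, y})" ..
    have "Lower (inclusion_order A) {x, y} = {z \<in> A. z \<subseteq> x \<and> z \<subseteq> y}"
      using xy unfolding Lower_def inclusion_order_def by auto
    moreover obtain i where "i \<in> A" "\<forall>z\<in>A. z \<subseteq> i \<longleftrightarrow> z \<subseteq> x \<and> z \<subseteq> y"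
      using assms(2)[OF xy] by blast
    ultimately have "greatest (inclusion_order A) i (Lower (inclusion_order A) {x, y})"
      by (simp add: greatest_def inclusion_order_def) blast
    then show "\<exists>i. greatest (inclusion_order A) i (Lower (inclusion_order A) {x, y})" ..
  qed
qed

lemma homomorphic_class_Un: "homomorphic_class K \<Longrightarrow> homomorphic_class K' \<Longrightarrow> homomorphic_class (K \<union> K')"
  unfolding homomorphic_class_def by blast

lemma homomorphic_class_Int: "homomorphic_class K \<Longrightarrow> homomorphic_class K' \<Longrightarrow> homomorphic_class (K \<inter> K')"
  unfolding homomorphic_class_def by blast

lemma lattice_homomorphic_classes: "lattice homomorphic_classes"
  unfolding homomorphic_classes_def
proof (rule lattice_inclusion_orderI)
  fix K K' :: "'v graph set"
  assume "K \<in> {K. homomorphic_class K}" "K' \<in> {K. homomorphic_class K}"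
  then have "K \<union> K' \<in> {K. homomorphic_class K}" "K \<inter> K' \<in> {K. homomorphic_class K}"
    by (simp_all add: homomorphic_class_Un homomorphic_class_Int)
  then show "\<exists>s\<in>{K. homomorphic_class K}. \<forall>z\<in>{K. homomorphic_class K}. s \<subseteq> z \<longleftrightarrow> K \<subseteq> z \<and> K' \<subseteq> z"
    "\<exists>i\<in>{K. homomorphic_class K}. \<forall>z\<in>{K. homomorphic_class K}. z \<subseteq> i \<longleftrightarrow> z \<subseteq> K \<and> z \<subseteq> K'"
    by (meson Un_subset_iff Int_subset_iff)+
qed

text \<open>The join in \<open>A\<close> is the preimage of an intersection and the meet that of a
  union, so nothing need be known about unions of logics.\<close>

lemma lattice_dual_transfer:
  assumes iso: "dually_isomorphic (inclusion_order A) (inclusion_order C)"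
    and Un: "\<And>x y. x \<in> C \<Longrightarrow> y \<in> C \<Longrightarrow> x \<union> y \<in> C"
    and Int: "\<And>x y. x \<in> C \<Longrightarrow> y \<in> C \<Longrightarrow> x \<inter> y \<in> C"
  shows "lattice (inclusion_order A)"
proof -
  obtain f where f: "f ` A = C" and le: "\<And>x y. x \<in> A \<Longrightarrow> y \<in> A \<Longrightarrow> x \<subseteq> y \<longleftrightarrow> f y \<subseteq> f x"
    using iso by (auto simp: dually_isomorphic_def inclusion_order_def bij_betw_def)
  show ?thesis
  proof (rule lattice_inclusion_orderI)
    fix x y assume xy: "x \<in> A" "y \<in> A"
    then have "f x \<inter> f y \<in> f ` A" "f x \<union> f y \<in> f ` A" using f Un Int by blast+
    then obtain s i where "s \<in> A" "f s = f x \<inter> f y" "i \<in> A" "f i = f x \<union> f y" by (metis imageE)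
    with xy have "\<forall>z\<in>A. s \<subseteq> z \<longleftrightarrow> x \<subseteq> z \<and> y \<subseteq> z" "\<forall>z\<in>A. z \<subseteq> i \<longleftrightarrow> z \<subseteq> x \<and> z \<subseteq> y"
      by (simp_all add: le)
    with \<open>s \<in> A\<close> \<open>i \<in> A\<close> show "\<exists>s\<in>A. \<forall>z\<in>A. s \<subseteq> z \<longleftrightarrow> x \<subseteq> z \<and> y \<subseteq> z"
      "\<exists>i\<in>A. \<forall>z\<in>A. z \<subseteq> i \<longleftrightarrow> z \<subseteq> x \<and> z \<subseteq> y"
      by blast+
  qed
qed

theorem theorem10p6:
  shows "lattice finitary_explosive_extensions \<and>
    lattice (homomorphic_classes :: 'v::infinite graph set gorder) \<and>
    dually_isomorphic finitary_explosive_extensions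
      (homomorphic_classes :: 'v::infinite graph set gorder)"
proof (intro conjI)
  show iso: "dually_isomorphic finitary_explosive_extensions
      (homomorphic_classes :: 'v graph set gorder)"
    by (rule dually_isomorphic_extensions_classes)
  show "lattice (homomorphic_classes :: 'v graph set gorder)"
    by (rule lattice_homomorphic_classes)
  show "lattice finitary_explosive_extensions"
    using iso unfolding finitary_explosive_extensions_def homomorphic_classes_def
    by (rule lattice_dual_transfer) (simp_all add: homomorphic_class_Un homomorphic_class_Int)
qed

end
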